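(* Let $D \geq 2$ be a squarefree integer, let $K = \mathbb{Q}(\sqrt{D})$ with ring of integers $\mathcal{O}_K$ and discriminant $\Delta$, and let $m \geq 1$ be an integer. If $\alpha \in \mathcal{O}_K^+$ can be represented as a sum of indecomposables in at most $m$ ways, i.e. $p_K(\alpha\,|\,\mathcal{I}) \leq m$, then \[ \mathrm{N}(\alpha) < m^2(2m+1)(2m+3)\cdot \sqrt{\Delta}\left(\sqrt{\Delta}+2\right)^2 . \]
   Context: $\mathcal{O}_K^+$ denotes the set of totally positive elements of $\mathcal{O}_K$ (elements $\alpha$ with $\alpha>0$ and $\alpha'>0$, where $\alpha'$ is the Galois conjugate). $\mathrm{N}(\alpha)=\alpha\alpha'$ is the norm. The discriminant is $\Delta = D$ if $D \equiv 1 \pmod 4$ and $\Delta = 4D$ if $D \equiv 2,3 \pmod 4$. An element $\alpha \in \mathcal{O}_K^+$ is indecomposable if there are no $\beta,\gamma \in \mathcal{O}_K^+$ with $\alpha=\beta+\gamma$. For $\alpha\in\mathcal{O}_K^+$, $p_K(\alpha\,|\,\mathcal{I})$ is the number of ways to write $\alpha = \lambda_1+\dots+\lambda_\ell$ ($\ell\ge 1$) with all $\lambda_i$ indecomposable, where representations differing only in the order of the summands are counted as the same. *)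

theory Defs
  imports "HOL-Analysis.Analysis" "HOL-Computational_Algebra.Computational_Algebra"
begin

(* The real quadratic field K = Q(sqrt D), as a subfield of the reals. *)
definition quad_field :: "int \<Rightarrow> real set" where
  "quad_field D = {a + b * sqrt (of_int D) | a b. a \<in> \<rat> \<and> b \<in> \<rat>}"

definition ring_of_ints :: "int \<Rightarrow> real set" where
  "ring_of_ints D = {x \<in> quad_field D. algebraic_int x}"

(* Galois conjugation a + b * sqrt D |-> a - b * sqrt D.  It is meaningful only on quad_field D with
   sqrt D irrational; see quad_conj_eq. *)
definition quad_conj :: "int \<Rightarrow> real \<Rightarrow> real" where
  "quad_conj D x =
     (THE y. \<exists>a\<in>\<rat>. \<exists>b\<in>\<rat>. x = a + b * sqrt (of_int D) \<and> y = a - b * sqrt (of_int D))"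

definition quad_norm :: "int \<Rightarrow> real \<Rightarrow> real" where
  "quad_norm D x = x * quad_conj D x"

definition quad_discr :: "int \<Rightarrow> int" where
  "quad_discr D = (if D mod 4 = 1 then D else 4 * D)"

definition tot_pos_ints :: "int \<Rightarrow> real set" where
  "tot_pos_ints D = {x \<in> ring_of_ints D. x > 0 \<and> quad_conj D x > 0}"

definition indecomposables :: "int \<Rightarrow> real set" where
  "indecomposables D =
     {x \<in> tot_pos_ints D. \<not> (\<exists>y\<in>tot_pos_ints D. \<exists>z\<in>tot_pos_ints D. x = y + z)}"

definition indec_partitions :: "int \<Rightarrow> real \<Rightarrow> real multiset set" where
  "indec_partitions D x = {M. M \<noteq> {#} \<and> set_mset M \<subseteq> indecomposables D \<and> sum_mset M = x}"

(* For squarefree D \<ge> 2 the set is finite: an element of tot_pos_ints D has a positive integer as its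
   trace, and only finitely many of them have a given trace.  So card is the true number of
   partitions, not the default value 0 for an infinite set. *)
definition num_indec_partitions :: "int \<Rightarrow> real \<Rightarrow> nat" where
  "num_indec_partitions D x = card (indec_partitions D x)"

lemma sqrt_squarefree_irrational:
  fixes D :: int
  assumes "D \<ge> 2" "squarefree D"
  shows "sqrt (of_int D) \<notin> \<rat>"
proof
  assume "sqrt (of_int D) \<in> \<rat>"
  moreover have "algebraic_int (sqrt (of_int D))"
    by (rule algebraic_int_root[of "of_int D" "monom 1 2"])
       (use assms in \<open>auto simp: poly_monom degree_monom_eq\<close>)
  ultimately have "sqrt (of_int D) \<in> \<int>"
    using rational_algebraic_int_is_int by blast
  then obtain k where k: "sqrt (of_int D) = of_int k"
    by (auto elim: Ints_cases)
  have "real_of_int D = (sqrt (of_int D))\<^sup>2"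
    using assms(1) by simp
  also have "\<dots> = of_int (k\<^sup>2)"
    by (simp add: k)
  finally have D: "D = k\<^sup>2"
    using of_int_eq_iff by blast
  then have "k dvd 1"
    using squarefreeD[OF assms(2), of k] by simp
  then have "\<bar>k\<bar> = 1"
    by simp
  then have "D = 1"
    using D by (metis power2_abs one_power2)
  with assms(1) show False
    by simp
qed

lemma quad_conj_eq:
  fixes D :: int
  assumes "D \<ge> 2" "squarefree D" and ab: "a \<in> \<rat>" "b \<in> \<rat>"
  shows "quad_conj D (a + b * sqrt (of_int D)) = a - b * sqrt (of_int D)"
  unfolding quad_conj_def
proof (rule the_equality)
  fix y
  let ?s = "sqrt (real_of_int D)"
  assume "\<exists>a'\<in>\<rat>. \<exists>b'\<in>\<rat>. a + b * ?s = a' + b' * ?s \<and> y = a' - b' * ?s"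
  then obtain a' b' where *: "a' \<in> \<rat>" "b' \<in> \<rat>" "a + b * ?s = a' + b' * ?s" "y = a' - b' * ?s"
    by blast
  have "b = b'"
  proof (rule ccontr)
    assume "b \<noteq> b'"
    then have "?s = (a' - a) / (b - b')"
      using *(3) by (simp add: field_simps)
    also have "\<dots> \<in> \<rat>"
      using * ab by (intro Rats_divide Rats_diff)
    finally show False
      using sqrt_squarefree_irrational[OF assms(1,2)] by simp
  qed
  then show "y = a - b * ?s"
    using * by simp
qed (use ab in blast)

end

(*
  Write s for the square root of the discriminant and x' for the conjugate of x. Every totally positive alpha
  lies in the cone of a lattice basis (beta, gamma) of totally positive elements; if the sum of the traces is
  minimal, neither difference of the basis vectors is totally positive, which forces both to be indecomposable.
  Write alpha = e beta + f gamma.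

  If v > s / N(beta) + 1, then v beta = z + w with z, w totally positive and z not a multiple of beta. Trading
  v copies of beta for partitions of z and w can be repeated e div v times and changes the partition every time,
  so at most m partitions force e <= m (s / N(beta) + 2), and likewise for f and gamma.

  Since 1 <= N(beta) <= s^2 / 4, both e and e sqrt(N(beta)) are at most M = m (s + 2), and the mixed trace
  beta gamma' + beta' gamma is at most s + 2 sqrt(N(beta) N(gamma)). Expanding N(e beta + f gamma) yields
  N(alpha) <= (s + 4) M^2, which is below the bound because s > 2.
*)

theory Submission
  imports Defs
begin

subsection \<open>Quadratic integers\<close>

lemma map_poly_of_int_add:
  "map_poly of_int (p + q) = (map_poly of_int p + map_poly of_int q :: 'a :: ring_char_0 poly)"
  by (rule poly_eqI) (simp add: coeff_map_poly)

lemma map_poly_of_int_mult: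
  "map_poly of_int (p * q) = (map_poly of_int p * map_poly of_int q :: 'a :: {ring_char_0, comm_ring_1} poly)"
  by (rule poly_eqI) (simp add: coeff_map_poly coeff_mult)

lemma map_poly_of_int_smult:
  "map_poly of_int (smult c p) = (smult (of_int c) (map_poly of_int p) :: 'a :: {ring_char_0, comm_ring_1} poly)"
  by (rule poly_eqI) (simp add: coeff_map_poly)

text \<open>Gauss's lemma: the primitive quadratic polynomial of \<open>x\<close> divides every integer polynomial that
  vanishes at \<open>x\<close>; dividing a monic one, it is monic up to sign.\<close>

lemma monic_quadratic_of_algebraic_int:
  fixes x :: real
  assumes irr: "x \<notin> \<rat>" and alg: "algebraic_int x"
    and root: "of_int u * x\<^sup>2 + of_int v * x + of_int w = 0" and u: "u \<noteq> 0"
  obtains b c :: int where "x\<^sup>2 + of_int b * x + of_int c = 0"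
proof -
  let ?ev = "\<lambda>p. poly (map_poly of_int p :: real poly) x"
  have ev_mult: "?ev (p * q) = ?ev p * ?ev q" for p q
    by (simp add: map_poly_of_int_mult)
  have ev_add: "?ev (p + q) = ?ev p + ?ev q" for p q
    by (simp add: map_poly_of_int_add)
  have ev_smult: "?ev (smult c p) = of_int c * ?ev p" for c p
    by (simp add: map_poly_of_int_smult)
  have ev_quad: "?ev [:c0, c1, c2:] = of_int c2 * x\<^sup>2 + of_int c1 * x + of_int c0" for c0 c1 c2
    by (simp add: map_poly_pCons algebra_simps power2_eq_square)
  define f where "f = [:w, v, u:]"
  define g where "g = primitive_part f"
  have f: "f = smult (content f) g" "f \<noteq> 0" and deg_g: "degree g = 2"
    using u by (simp_all add: f_def g_def)
  have "?ev f = 0"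
    using root by (simp add: f_def ev_quad)
  then have ev_g: "?ev g = 0"
    using f ev_smult[of "content f" g] by simp
  have g0: "g \<noteq> 0" and content_g: "content g = 1"
    using f by (auto simp: g_def)
  obtain p where p: "?ev p = 0" "lead_coeff p = 1"
    using alg by (auto simp: algebraic_int_altdef_ipoly)
  \<comment> \<open>Over the integers, division with remainder needs a scaling factor
    \<open>a\<close>. It is cancelled again below: \<open>g\<close> is primitive, so
    \<open>a\<close> divides the content of \<open>q\<close>.\<close>
  obtain a q r where a: "a \<noteq> 0" and div: "smult a p = g * q + r" and r: "r = 0 \<or> degree r < degree g"
    using pseudo_mod[OF g0, of p] by blast
  have ev_r: "?ev r = 0"
    using arg_cong[OF div, of ?ev] p ev_g by (simp add: ev_mult ev_add ev_smult)
  \<comment> \<open>A nonzero remainder has degree at most 1 and root \<open>x\<close>, which would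
    make \<open>x\<close> rational.\<close>
  have "r = 0"
  proof (rule ccontr)
    assume "r \<noteq> 0"
    with r deg_g have "degree r \<le> 1"
      by simp
    then have r_eq: "r = [:coeff r 0, coeff r 1:]"
      by (intro poly_eqI) (auto simp: coeff_pCons coeff_eq_0 split: nat.split)
    then have eq: "of_int (coeff r 0) + of_int (coeff r 1) * x = 0"
      using ev_r ev_quad[of "coeff r 0" "coeff r 1" 0, simplified, folded One_nat_def r_eq] by (simp add: ac_simps)
    have "coeff r 1 \<noteq> 0"
      using eq r_eq \<open>r \<noteq> 0\<close> by auto
    then have "x = - of_int (coeff r 0) / of_int (coeff r 1)"
      using eq by (simp add: field_simps)
    with irr show False
      by (metis Rats_divide Rats_minus_iff Rats_of_int)
  qed
  with div have div': "smult a p = g * q"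
    by simp
  have "content q = \<bar>a\<bar> * content p"
    using arg_cong[OF div', of content] content_g by (simp add: content_mult)
  then have "a dvd content q"
    by simp
  then obtain q' where q': "q = smult a q'"
    unfolding const_poly_dvd_iff_dvd_content[symmetric] by (auto elim: dvdE)
  have "p = g * q'"
    using div' a q' by (metis mult_smult_right smult_cancel)
  then have "lead_coeff g * lead_coeff q' = 1"
    using p(2) by (simp add: lead_coeff_mult)
  then have "\<bar>coeff g 2\<bar> = 1"
    using deg_g by (auto simp: zmult_eq_1_iff)
  moreover have g_eq: "g = [:coeff g 0, coeff g 1, coeff g 2:]"
    using deg_g by (intro poly_eqI) (auto simp: coeff_pCons coeff_eq_0 numeral_2_eq_2 split: nat.split)
  then have g_root: "of_int (coeff g 2) * x\<^sup>2 + of_int (coeff g 1) * x + of_int (coeff g 0) = 0"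
    using ev_g ev_quad[of "coeff g 0" "coeff g 1" "coeff g 2", folded g_eq] by simp
  ultimately have "coeff g 2 = 1 \<or> coeff g 2 = -1"
    by linarith
  then show ?thesis
    using that[of "coeff g 1" "coeff g 0"] that[of "- coeff g 1" "- coeff g 0"] g_root by auto
qed

text \<open>For \<open>b = u / w\<close> in lowest terms, the square of \<open>w\<close> divides D
  u^2 and is coprime to u^2. Hence it divides the squarefree \<open>D\<close>, and \<open>w\<close>
  is a unit.\<close>

lemma of_int_mult_square_in_Ints:
  fixes D :: int and b :: real
  assumes "squarefree D" "b \<in> \<rat>" "of_int D * b\<^sup>2 \<in> \<int>"
  shows "b \<in> \<int>"
proof -
  obtain u w where uw: "w > 0" "coprime u w" "b = of_int u / of_int w"
    using assms(2) by (elim Rats_cases')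
  obtain k where "of_int D * b\<^sup>2 = of_int k"
    using assms(3) by (elim Ints_cases)
  then have "of_int D * (of_int u)\<^sup>2 = (of_int k * (of_int w)\<^sup>2 :: real)"
    using uw by (simp add: field_simps)
  then have eq: "D * u\<^sup>2 = k * w\<^sup>2"
    by (metis of_int_eq_iff of_int_mult of_int_power)
  have "w\<^sup>2 dvd D * u\<^sup>2"
    using eq by simp
  moreover have "coprime (w\<^sup>2) (u\<^sup>2)"
    using uw(2) by (simp add: coprime_commute)
  ultimately have "w\<^sup>2 dvd D"
    by (simp add: coprime_dvd_mult_left_iff)
  then have "w dvd 1"
    using assms(1) by (auto dest: squarefreeD)
  then show ?thesis
    using uw by simp
qed

section \<open>The integral basis 1, \<omega> of the ring of integers\<close>

locale real_quadratic =
  fixes D :: int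
  assumes D_ge_2: "D \<ge> 2" and squarefree_D: "squarefree D"
begin

abbreviation conj :: "real \<Rightarrow> real" where
  "conj \<equiv> quad_conj D"

definition s :: real where
  "s = sqrt (of_int (quad_discr D))"

text \<open>In both cases the conjugate is \<open>\<omega> - s\<close>, which is how it is written
  throughout.\<close>

definition \<omega> :: real where
  "\<omega> = (if D mod 4 = 1 then (1 + sqrt (of_int D)) / 2 else sqrt (of_int D))"

lemma s_eq: "s = (if D mod 4 = 1 then sqrt (of_int D) else 2 * sqrt (of_int D))"
  by (simp add: s_def quad_discr_def real_sqrt_mult)

lemma s_gt_2: "s > 2"
proof -
  have "quad_discr D > 4"
    using D_ge_2 by (auto simp: quad_discr_def) presburger
  then have "sqrt 4 < s"
    unfolding s_def by (intro real_sqrt_less_mono) linarith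
  then show ?thesis
    by simp
qed

lemma sqrt_D_irrational: "sqrt (of_int D) \<notin> \<rat>"
  using sqrt_squarefree_irrational[OF D_ge_2 squarefree_D] .

lemma omega_irrational: "\<omega> \<notin> \<rat>"
proof
  assume "\<omega> \<in> \<rat>"
  then have "(if D mod 4 = 1 then 2 * \<omega> - 1 else \<omega>) \<in> \<rat>"
    by auto
  also have "(if D mod 4 = 1 then 2 * \<omega> - 1 else \<omega>) = sqrt (of_int D)"
    by (simp add: \<omega>_def field_simps)
  finally show False
    using sqrt_D_irrational by simp
qed

lemma D_mod_4_neq_0: "D mod 4 \<noteq> 0"
proof
  assume "D mod 4 = 0"
  then have "2\<^sup>2 dvd D"
    by (simp add: mod_eq_0_iff_dvd)
  then show False
    using squarefreeD[OF squarefree_D, of 2] by simp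
qed

text \<open>\<open>t\<close> and \<open>n\<close> are the trace and the norm of \<omega>: 1 and (1 -
  D)/4 if D is 1 modulo 4, otherwise 0 and -D.\<close>

lemma obtain_omega_polynomial:
  obtains t n :: int where "\<omega> + (\<omega> - s) = of_int t" "\<omega> * (\<omega> - s) = of_int n"
proof (cases "D mod 4 = 1")
  case True
  then have "D = 4 * (D div 4) + 1"
    by presburger
  then have *: "of_int D = 4 * of_int (D div 4) + (1 :: real)"
    by (metis of_int_1 of_int_add of_int_mult of_int_numeral)
  have sq: "sqrt (of_int D) * sqrt (of_int D) = of_int D"
    using D_ge_2 by simp
  show ?thesis
    using True sq * by (intro that[of 1 "- (D div 4)"]) (simp_all add: \<omega>_def s_eq field_simps)
next
  case False
  then show ?thesis
    using D_ge_2 by (intro that[of 0 "- D"]) (simp_all add: \<omega>_def s_eq)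
qed

lemma conj_lattice: "conj (of_int p + of_int q * \<omega>) = of_int p + of_int q * (\<omega> - s)"
proof (cases "D mod 4 = 1")
  case True
  have "conj ((of_int p + of_int q / 2) + (of_int q / 2) * sqrt (of_int D))
      = (of_int p + of_int q / 2) - (of_int q / 2) * sqrt (of_int D)"
    by (rule quad_conj_eq[OF D_ge_2 squarefree_D]) auto
  then show ?thesis
    using True by (simp add: \<omega>_def s_eq field_simps)
next
  case False
  then show ?thesis
    using quad_conj_eq[OF D_ge_2 squarefree_D, of "of_int p" "of_int q"]
    by (simp add: \<omega>_def s_eq algebra_simps)
qed

lemma lattice_in_ring_of_ints: "of_int p + of_int q * \<omega> \<in> ring_of_ints D" (is "?x \<in> _")
proof -
  obtain t n where tn: "\<omega> + (\<omega> - s) = of_int t" "\<omega> * (\<omega> - s) = of_int n"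
    by (rule obtain_omega_polynomial)
  \<comment> \<open>The characteristic polynomial of \<open>?x\<close>, with its norm and its
    negated trace as lower coefficients.\<close>
  let ?f = "[:p * p + p * q * t + q * q * n, - (2 * p + q * t), 1:]"
  have "algebraic_int ?x"
    unfolding algebraic_int_altdef_ipoly
  proof (intro exI conjI)
    have "poly (map_poly of_int ?f) ?x
      = of_int p * of_int p + of_int p * of_int q * (\<omega> + (\<omega> - s)) + of_int q * of_int q * (\<omega> * (\<omega> - s))
        - (2 * of_int p + of_int q * (\<omega> + (\<omega> - s))) * ?x + ?x * ?x"
      unfolding tn by (simp add: map_poly_pCons algebra_simps)
    also have "\<dots> = 0"
      by (simp add: algebra_simps)
    finally show "poly (map_poly of_int ?f) ?x = 0" .
  qed simp
  moreover have "?x \<in> quad_field D"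
  proof (cases "D mod 4 = 1")
    case True
    then have "?x = (of_int p + of_int q / 2) + (of_int q / 2) * sqrt (of_int D)"
      by (simp add: \<omega>_def field_simps)
    moreover have "(of_int p + of_int q / 2 :: real) \<in> \<rat>" "(of_int q / 2 :: real) \<in> \<rat>"
      by auto
    ultimately show ?thesis
      unfolding quad_field_def by blast
  next
    case False
    then have "?x = of_int p + of_int q * sqrt (of_int D)"
      by (simp add: \<omega>_def)
    moreover have "(of_int p :: real) \<in> \<rat>" "(of_int q :: real) \<in> \<rat>"
      by auto
    ultimately show ?thesis
      unfolding quad_field_def by blast
  qed
  ultimately show ?thesis
    by (simp add: ring_of_ints_def)
qed

text \<open>\<open>A\<close> and \<open>N\<close> are the trace and the norm of \<open>x\<close>.
  For irrational \<open>x\<close>, the monic integer quadratic vanishing at \<open>x\<close> must be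
  its characteristic polynomial, so 2a and a^2 - D b^2 are integers. Then D (2b)^2 is an integer
  too, and squarefreeness of \<open>D\<close> makes 2b one.\<close>

lemma ring_of_ints_obtain_half_integers:
  assumes "x \<in> ring_of_ints D"
  obtains A B N :: int
  where "x = (of_int A + of_int B * sqrt (of_int D)) / 2" "A\<^sup>2 - D * B\<^sup>2 = 4 * N"
proof -
  obtain a b where ab: "a \<in> \<rat>" "b \<in> \<rat>" and x: "x = a + b * sqrt (of_int D)" and alg: "algebraic_int x"
    using assms by (auto simp: ring_of_ints_def quad_field_def)
  have irr: "c = 0 \<and> d = 0" if "c + d * sqrt (of_int D) = 0" "c \<in> \<rat>" "d \<in> \<rat>" for c d
  proof -
    have "d = 0"
    proof (rule ccontr)
      assume "d \<noteq> 0"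
      then have "sqrt (of_int D) = - c / d"
        using that by (simp add: field_simps)
      also have "\<dots> \<in> \<rat>"
        using that by auto
      finally show False
        using sqrt_D_irrational by simp
    qed
    with that show ?thesis
      by simp
  qed
  show ?thesis
  proof (cases "b = 0")
    case True
    then have "x \<in> \<int>"
      using alg ab x by (simp add: rational_algebraic_int_is_int)
    then obtain k where "x = of_int k"
      by (elim Ints_cases)
    then show ?thesis
      by (intro that[of "2 * k" 0 "k\<^sup>2"]) (simp_all add: power2_eq_square)
  next
    case False
    have x_irr: "x \<notin> \<rat>"
    proof
      assume "x \<in> \<rat>"
      then have "b = 0"
        using irr[of "a - x" b, OF _ Rats_diff[OF ab(1)] ab(2)] x by simp
      with False show False ..
    qed
    obtain A\<^sub>1 A\<^sub>2 where A: "A\<^sub>2 > 0" "a = of_int A\<^sub>1 / of_int A\<^sub>2"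
      using ab(1) by (elim Rats_cases')
    obtain B\<^sub>1 B\<^sub>2 where B: "B\<^sub>2 > 0" "b = of_int B\<^sub>1 / of_int B\<^sub>2"
      using ab(2) by (elim Rats_cases')
    \<comment> \<open>The coefficients of the characteristic polynomial after clearing
      denominators.\<close>
    let ?u = "A\<^sub>2\<^sup>2 * B\<^sub>2\<^sup>2" and ?v = "- 2 * A\<^sub>1 * A\<^sub>2 * B\<^sub>2\<^sup>2"
      and ?w = "A\<^sub>1\<^sup>2 * B\<^sub>2\<^sup>2 - D * B\<^sub>1\<^sup>2 * A\<^sub>2\<^sup>2"
    have min_root: "x\<^sup>2 - 2 * a * x + (a\<^sup>2 - of_int D * b\<^sup>2) = 0"
      using D_ge_2 by (simp add: x power2_eq_square algebra_simps)
    have "of_int ?u * x\<^sup>2 + of_int ?v * x + of_int ?w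
        = of_int ?u * (x\<^sup>2 - 2 * a * x + (a\<^sup>2 - of_int D * b\<^sup>2))"
      using A(1) B(1) unfolding A(2) B(2) by (simp add: field_simps power2_eq_square)
    also have "\<dots> = 0"
      by (simp add: min_root)
    finally have "of_int ?u * x\<^sup>2 + of_int ?v * x + of_int ?w = 0" .
    moreover have "?u \<noteq> 0"
      using A(1) B(1) by simp
    ultimately obtain \<beta> \<gamma> :: int where root: "x\<^sup>2 + of_int \<beta> * x + of_int \<gamma> = 0"
      using monic_quadratic_of_algebraic_int[OF x_irr alg] by metis
    \<comment> \<open>The difference of the two monic quadratics at \<open>x\<close>, sorted into a
      rational part and a rational multiple of the square root of \<open>D\<close>; both must
      vanish.\<close>
    have "((of_int \<gamma> - (a\<^sup>2 - of_int D * b\<^sup>2)) + (of_int \<beta> + 2 * a) * a)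
        + ((of_int \<beta> + 2 * a) * b) * sqrt (of_int D) = 0"
      using root min_root by (simp add: x algebra_simps)
    then have eqs: "(of_int \<beta> + 2 * a) * b = 0"
        "(of_int \<gamma> - (a\<^sup>2 - of_int D * b\<^sup>2)) + (of_int \<beta> + 2 * a) * a = 0"
      using irr ab by (meson Rats_add Rats_diff Rats_mult Rats_of_int Rats_power Rats_number_of)+
    have a: "2 * a = of_int (- \<beta>)"
      using eqs(1) False by simp
    have c: "a\<^sup>2 - of_int D * b\<^sup>2 = of_int \<gamma>"
      using eqs(2) a by simp
    have "of_int D * (2 * b)\<^sup>2 = (2 * a)\<^sup>2 - 4 * of_int \<gamma>"
      unfolding c[symmetric] by (simp add: power_mult_distrib)
    then have Db: "of_int D * (2 * b)\<^sup>2 = of_int ((- \<beta>)\<^sup>2 - 4 * \<gamma>)"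
      unfolding a by simp
    then have "of_int D * (2 * b)\<^sup>2 \<in> \<int>"
      by (metis Ints_of_int)
    then have "2 * b \<in> \<int>"
      using of_int_mult_square_in_Ints[OF squarefree_D, of "2 * b"] ab(2) by auto
    then obtain B' where B': "2 * b = of_int B'"
      by (elim Ints_cases)
    show ?thesis
    proof (rule that)
      show "x = (of_int (- \<beta>) + of_int B' * sqrt (of_int D)) / 2"
        unfolding x using a B' by (simp add: field_simps)
      have "of_int (D * B'\<^sup>2) = (of_int ((- \<beta>)\<^sup>2 - 4 * \<gamma>) :: real)"
        using Db B' by simp
      then have "D * B'\<^sup>2 = (- \<beta>)\<^sup>2 - 4 * \<gamma>"
        by (rule of_int_eq_iff[THEN iffD1])
      then show "(- \<beta>)\<^sup>2 - D * B'\<^sup>2 = 4 * \<gamma>"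
        by simp
    qed
  qed
qed

text \<open>Squares are 0 or 1 modulo 4. So 4 dividing A^2 - D B^2 forces A and B to have equal
  parity if D is 1 modulo 4, and to be both even if D is 2 or 3 modulo 4.\<close>

lemma ring_of_ints_cases:
  assumes "x \<in> ring_of_ints D"
  obtains p q :: int where "x = of_int p + of_int q * \<omega>"
proof -
  obtain A B N where x: "x = (of_int A + of_int B * sqrt (of_int D)) / 2" and N: "A\<^sup>2 - D * B\<^sup>2 = 4 * N"
    using assms by (rule ring_of_ints_obtain_half_integers)
  have "(A * A - (D mod 4) * (B * B)) mod 4 = (A\<^sup>2 - D * B\<^sup>2) mod 4"
    unfolding power2_eq_square by (metis mod_diff_right_eq mod_mult_left_eq)
  then have cong: "(A * A - (D mod 4) * (B * B)) mod 4 = 0"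
    using N by simp
  have sq: "(even c \<and> c * c mod 4 = 0) \<or> (odd c \<and> c * c mod 4 = 1)" for c :: int
  proof -
    have "c mod 4 \<in> {0, 1, 2, 3}"
      by auto
    moreover have "c * c mod 4 = (c mod 4) * (c mod 4) mod 4"
      by (simp add: mod_mult_eq)
    moreover have "even c \<longleftrightarrow> even (c mod 4)"
      by presburger
    ultimately show ?thesis
      by auto
  qed
  define a2 where "a2 = A * A"
  define b2 where "b2 = B * B"
  have sq2: "(even A \<and> a2 mod 4 = 0) \<or> (odd A \<and> a2 mod 4 = 1)"
    "(even B \<and> b2 mod 4 = 0) \<or> (odd B \<and> b2 mod 4 = 1)"
    using sq[of A] sq[of B] by (simp_all add: a2_def b2_def)
  have cong': "(a2 - (D mod 4) * b2) mod 4 = 0"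
    using cong by (simp add: a2_def b2_def)
  show ?thesis
  proof (cases "D mod 4 = 1")
    case True
    then have "even (A - B)"
      using sq2 cong' by simp presburger
    then obtain k where "A - B = 2 * k"
      by (elim evenE)
    then have "of_int A = (2 * of_int k + of_int B :: real)"
      by (metis of_int_add of_int_mult of_int_numeral diff_add_cancel)
    then have "x = of_int k + of_int B * \<omega>"
      using True by (simp add: x \<omega>_def field_simps)
    then show ?thesis
      by (rule that)
  next
    case False
    then have "D mod 4 = 2 \<or> D mod 4 = 3"
      using D_mod_4_neq_0 by presburger
    then have "even A \<and> even B"
      using sq2 cong' by (elim disjE) (simp, presburger)+
    then obtain k l where "A = 2 * k" "B = 2 * l"
      by (elim conjE evenE)
    then have "x = of_int k + of_int l * \<omega>"
      using False by (simp add: x \<omega>_def)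
    then show ?thesis
      by (rule that)
  qed
qed

section \<open>Linearity of conjugation; integrality of traces, norms and determinants\<close>

lemma ring_of_ints_combine:
  assumes "x \<in> ring_of_ints D" "y \<in> ring_of_ints D"
  shows "of_int k * x + of_int l * y \<in> ring_of_ints D"
    and "conj (of_int k * x + of_int l * y) = of_int k * conj x + of_int l * conj y"
proof -
  obtain p q where x: "x = of_int p + of_int q * \<omega>"
    using assms(1) by (rule ring_of_ints_cases)
  obtain p' q' where y: "y = of_int p' + of_int q' * \<omega>"
    using assms(2) by (rule ring_of_ints_cases)
  have eq: "of_int k * x + of_int l * y = of_int (k * p + l * p') + of_int (k * q + l * q') * \<omega>"
    by (simp add: x y algebra_simps)
  show "of_int k * x + of_int l * y \<in> ring_of_ints D"
    unfolding eq by (rule lattice_in_ring_of_ints)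
  show "conj (of_int k * x + of_int l * y) = of_int k * conj x + of_int l * conj y"
    unfolding eq conj_lattice by (simp add: x y conj_lattice algebra_simps)
qed

lemma ring_of_ints_add:
  assumes "x \<in> ring_of_ints D" "y \<in> ring_of_ints D"
  shows "x + y \<in> ring_of_ints D" and "conj (x + y) = conj x + conj y"
  using ring_of_ints_combine[OF assms, of 1 1] by simp_all

lemma ring_of_ints_diff:
  assumes "x \<in> ring_of_ints D" "y \<in> ring_of_ints D"
  shows "x - y \<in> ring_of_ints D" and "conj (x - y) = conj x - conj y"
  using ring_of_ints_combine[OF assms, of 1 "-1"] by simp_all

lemma ring_of_ints_scale:
  assumes "x \<in> ring_of_ints D"
  shows "of_int k * x \<in> ring_of_ints D" and "conj (of_int k * x) = of_int k * conj x"
  using ring_of_ints_combine[OF assms assms, of k 0] by simp_all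

lemma trace_in_Ints:
  assumes "x \<in> ring_of_ints D"
  shows "x + conj x \<in> \<int>"
proof -
  obtain p q where x: "x = of_int p + of_int q * \<omega>"
    using assms by (rule ring_of_ints_cases)
  obtain t n where tn: "\<omega> + (\<omega> - s) = of_int t" "\<omega> * (\<omega> - s) = of_int n"
    by (rule obtain_omega_polynomial)
  have "x + conj x = 2 * of_int p + of_int q * (\<omega> + (\<omega> - s))"
    unfolding x conj_lattice by (simp add: algebra_simps)
  also have "\<dots> = of_int (2 * p + q * t)"
    unfolding tn by simp
  finally show ?thesis
    by (metis Ints_of_int)
qed

lemma norm_in_Ints:
  assumes "x \<in> ring_of_ints D"
  shows "x * conj x \<in> \<int>"
proof -
  obtain p q where x: "x = of_int p + of_int q * \<omega>"
    using assms by (rule ring_of_ints_cases)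
  obtain t n where tn: "\<omega> + (\<omega> - s) = of_int t" "\<omega> * (\<omega> - s) = of_int n"
    by (rule obtain_omega_polynomial)
  have "x * conj x = of_int p * of_int p + of_int p * of_int q * (\<omega> + (\<omega> - s)) + of_int q * of_int q * (\<omega> * (\<omega> - s))"
    unfolding x conj_lattice by (simp add: algebra_simps)
  also have "\<dots> = of_int (p * p + p * q * t + q * q * n)"
    unfolding tn by simp
  finally show ?thesis
    by (metis Ints_of_int)
qed

lemma lattice_eq_0_iff: "of_int p + of_int q * \<omega> = 0 \<longleftrightarrow> p = 0 \<and> q = 0"
proof
  assume *: "of_int p + of_int q * \<omega> = 0"
  have "q = 0"
  proof (rule ccontr)
    assume "q \<noteq> 0"
    then have "\<omega> = - of_int p / of_int q"
      using * by (simp add: field_simps)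
    also have "\<dots> \<in> \<rat>"
      by auto
    finally show False
      using omega_irrational by simp
  qed
  with * show "p = 0 \<and> q = 0"
    by simp
qed simp

text \<open>The factor \<open>k\<close> is, up to sign, the determinant of the coordinates of
  \<open>x\<close> and \<open>y\<close> with respect to 1, \<omega>; the basis 1, \<omega> itself
  contributes \<open>s\<close>.\<close>

lemma det_eq_multiple_of_s:
  assumes "x \<in> ring_of_ints D" "y \<in> ring_of_ints D"
  obtains k :: int where "x * conj y - conj x * y = of_int k * s"
proof -
  obtain p q where x: "x = of_int p + of_int q * \<omega>"
    using assms(1) by (rule ring_of_ints_cases)
  obtain p' q' where y: "y = of_int p' + of_int q' * \<omega>"
    using assms(2) by (rule ring_of_ints_cases)
  have "x * conj y - conj x * y = of_int (q * p' - p * q') * s"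
    unfolding x y conj_lattice by (simp add: algebra_simps)
  then show ?thesis
    by (rule that)
qed

end

subsection \<open>Reduced bases and partitions\<close>

lemma sum_mset_repeat_mset: "sum_mset (repeat_mset n M) = of_nat n * (sum_mset M :: 'a :: comm_semiring_1)"
  by (induction n) (simp_all add: algebra_simps)

lemma set_mset_repeat_mset_subset: "set_mset (repeat_mset n M) \<subseteq> set_mset M"
  by (induction n) auto

lemma finite_multisets_size_le:
  assumes "finite A"
  shows "finite {M. set_mset M \<subseteq> A \<and> size M \<le> n}"
proof (rule finite_subset)
  show "{M. set_mset M \<subseteq> A \<and> size M \<le> n} \<subseteq> mset ` {xs. set xs \<subseteq> A \<and> length xs \<le> n}"
  proof
    fix M assume "M \<in> {M. set_mset M \<subseteq> A \<and> size M \<le> n}"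
    moreover obtain xs where "mset xs = M"
      using ex_mset by blast
    ultimately show "M \<in> mset ` {xs. set xs \<subseteq> A \<and> length xs \<le> n}"
      by auto
  qed
  show "finite (mset ` {xs. set xs \<subseteq> A \<and> length xs \<le> n})"
    using assms by (simp add: finite_lists_length_le)
qed

text \<open>Used to see that different numbers of exchanges produce different partitions. Comparing
  the count of each element leaves the desired equality multiplied by u - t > 0. The bound
  \<open>u * v \<le> e\<close> keeps the subtractions of naturals from being truncated.\<close>

lemma replicate_repeat_mset_inject:
  assumes "replicate_mset (e - t * v) \<beta> + repeat_mset t Z = replicate_mset (e - u * v) \<beta> + repeat_mset u Z"
    and "t < u" and "u * v \<le> e"
  shows "Z = replicate_mset v \<beta>"
proof (rule multiset_eqI)
  fix x
  have "count (replicate_mset (e - t * v) \<beta> + repeat_mset t Z) x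
      = count (replicate_mset (e - u * v) \<beta> + repeat_mset u Z) x"
    using assms(1) by simp
  then have *: "(if x = \<beta> then e - t * v else 0) + t * count Z x
      = (if x = \<beta> then e - u * v else 0) + u * count Z x"
    by simp
  obtain d where d: "u = t + d" "d > 0"
    using assms(2) less_imp_add_positive by blast
  show "count Z x = count (replicate_mset v \<beta>) x"
  proof (cases "x = \<beta>")
    case True
    have "e - t * v = e - u * v + d * v"
      using assms(3) d by (simp add: algebra_simps)
    then have "d * v = d * count Z x"
      using * True d by (simp add: algebra_simps)
    then show ?thesis
      using True d by simp
  next
    case False
    then show ?thesis
      using * d by (simp add: algebra_simps)
  qed
qed

section \<open>Reduced bases of totally positive elements\<close>

context real_quadratic
begin

text \<open>The determinant of the vectors (x, x') and (y, y') in the plane; lattice bases are the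
  pairs of integers for which its absolute value is \<open>s\<close>.\<close>

definition det :: "real \<Rightarrow> real \<Rightarrow> real" where
  "det x y = x * conj y - conj x * y"

lemma abs_det_commute: "\<bar>det x y\<bar> = \<bar>det y x\<bar>"
  by (simp add: det_def abs_minus_commute mult.commute)

lemma tot_pos_intsD:
  assumes "x \<in> tot_pos_ints D"
  shows "x \<in> ring_of_ints D" "x > 0" "conj x > 0"
  using assms by (auto simp: tot_pos_ints_def)

lemma tot_pos_intsI: "x \<in> ring_of_ints D \<Longrightarrow> x > 0 \<Longrightarrow> conj x > 0 \<Longrightarrow> x \<in> tot_pos_ints D"
  by (simp add: tot_pos_ints_def)

lemma tot_pos_ints_diff_iff:
  assumes "x \<in> ring_of_ints D" "y \<in> ring_of_ints D"
  shows "x - y \<in> tot_pos_ints D \<longleftrightarrow> y < x \<and> conj y < conj x"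
  using ring_of_ints_diff[OF assms] by (simp add: tot_pos_ints_def)

lemma indecomposablesD: "x \<in> indecomposables D \<Longrightarrow> x \<in> tot_pos_ints D"
  by (simp add: indecomposables_def)

lemma trace_ge_1:
  assumes "x \<in> tot_pos_ints D"
  shows "x + conj x \<ge> 1"
  using trace_in_Ints[of x] tot_pos_intsD[OF assms] by (auto elim!: Ints_cases)

lemma norm_ge_1:
  assumes "x \<in> tot_pos_ints D"
  shows "x * conj x \<ge> 1"
proof -
  have "x * conj x \<in> \<int>" "x * conj x > 0"
    using norm_in_Ints[of x] tot_pos_intsD[OF assms] by simp_all
  then show ?thesis
    by (auto elim!: Ints_cases)
qed

text \<open>Cramer's rule: the numerators are integer multiples of \<open>s\<close> and the
  denominator is \<open>s\<close> or \<open>- s\<close>.\<close>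

lemma basis_coordinates:
  assumes "\<beta> \<in> ring_of_ints D" "\<gamma> \<in> ring_of_ints D" "\<bar>det \<beta> \<gamma>\<bar> = s" "x \<in> ring_of_ints D"
  obtains p q :: int where "x = of_int p * \<beta> + of_int q * \<gamma>"
proof -
  obtain k where k: "det x \<gamma> = of_int k * s"
    using det_eq_multiple_of_s[OF assms(4,2)] unfolding det_def .
  obtain l where l: "det \<beta> x = of_int l * s"
    using det_eq_multiple_of_s[OF assms(1,4)] unfolding det_def .
  have cramer: "det \<beta> \<gamma> * x = det x \<gamma> * \<beta> + det \<beta> x * \<gamma>"
    by (simp add: det_def algebra_simps)
  have "det \<beta> \<gamma> = s \<or> det \<beta> \<gamma> = - s"
    using assms(3) by linarith
  then show ?thesis
  proof
    assume "det \<beta> \<gamma> = s"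
    with cramer have "s * x = s * (of_int k * \<beta> + of_int l * \<gamma>)"
      by (simp add: k l algebra_simps)
    then have "x = of_int k * \<beta> + of_int l * \<gamma>"
      using s_gt_2 by simp
    then show ?thesis
      by (rule that)
  next
    assume "det \<beta> \<gamma> = - s"
    with cramer have "s * x = s * (of_int (- k) * \<beta> + of_int (- l) * \<gamma>)"
      by (simp add: k l algebra_simps)
    then have "x = of_int (- k) * \<beta> + of_int (- l) * \<gamma>"
      using s_gt_2 by simp
    then show ?thesis
      by (rule that)
  qed
qed

text \<open>The starting point for the minimal choice below. Dividing the coordinates of \<alpha> by
  their gcd gives a primitive \<beta>, and Bezout coefficients complete it to a basis. Adding a
  large multiple of \<beta> to the second vector makes that vector totally positive and keeps the
  determinant.\<close>

lemma exists_tot_pos_basis_on_ray: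
  assumes "\<alpha> \<in> tot_pos_ints D"
  obtains \<beta> \<gamma> and n :: nat
  where "\<beta> \<in> tot_pos_ints D" "\<gamma> \<in> tot_pos_ints D" "\<bar>det \<beta> \<gamma>\<bar> = s" "\<alpha> = of_nat n * \<beta>"
proof -
  note \<alpha> = tot_pos_intsD[OF assms]
  obtain p q where pq: "\<alpha> = of_int p + of_int q * \<omega>"
    using \<alpha>(1) by (rule ring_of_ints_cases)
  define g where "g = gcd p q"
  have "p \<noteq> 0 \<or> q \<noteq> 0"
    using pq \<alpha>(2) by auto
  then have g: "g > 0"
    by (simp add: g_def)
  define p0 q0 where "p0 = p div g" and "q0 = q div g"
  have p0: "p = g * p0" and q0: "q = g * q0"
    by (simp_all add: g_def p0_def q0_def)
  obtain u v where "u * p + v * q = g"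
    unfolding g_def using bezout_int by blast
  then have "g * (u * p0 + v * q0) = g * 1"
    by (simp add: p0 q0 algebra_simps)
  then have uv: "u * p0 + v * q0 = 1"
    using g by (metis mult_left_cancel less_irrefl)
  define \<beta> where "\<beta> = of_int p0 + of_int q0 * \<omega>"
  have \<beta>_ring: "\<beta> \<in> ring_of_ints D"
    unfolding \<beta>_def by (rule lattice_in_ring_of_ints)
  have \<alpha>_eq: "\<alpha> = of_int g * \<beta>"
    by (simp add: pq p0 q0 \<beta>_def algebra_simps)
  then have "conj \<alpha> = of_int g * conj \<beta>"
    using ring_of_ints_scale(2)[OF \<beta>_ring] by simp
  then have \<beta>: "\<beta> > 0" "conj \<beta> > 0"
    using \<alpha>(2,3) \<alpha>_eq g by (simp_all add: zero_less_mult_iff)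
  define \<delta> where "\<delta> = of_int (- v) + of_int u * \<omega>"
  have \<delta>_ring: "\<delta> \<in> ring_of_ints D"
    unfolding \<delta>_def by (rule lattice_in_ring_of_ints)
  have "det \<beta> \<delta> = - (of_int (u * p0 + v * q0) * s)"
    unfolding det_def \<beta>_def \<delta>_def conj_lattice by (simp add: algebra_simps)
  then have det: "det \<beta> \<delta> = - s"
    by (simp add: uv)
  obtain t :: nat where t: "max (- \<delta> / \<beta>) (- conj \<delta> / conj \<beta>) < of_nat t"
    using reals_Archimedean2 by blast
  define \<gamma> where "\<gamma> = of_int 1 * \<delta> + of_int (int t) * \<beta>"
  have \<gamma>_ring: "\<gamma> \<in> ring_of_ints D" and conj_\<gamma>: "conj \<gamma> = conj \<delta> + of_nat t * conj \<beta>"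
    using ring_of_ints_combine[OF \<delta>_ring \<beta>_ring, of 1 "int t"] by (simp_all add: \<gamma>_def)
  have "\<gamma> > 0" "conj \<gamma> > 0"
    unfolding conj_\<gamma> using t \<beta> by (simp_all add: \<gamma>_def field_simps)
  moreover have "det \<beta> \<gamma> = det \<beta> \<delta>"
    unfolding det_def conj_\<gamma> by (simp add: \<gamma>_def algebra_simps)
  moreover have "\<alpha> = of_nat (nat g) * \<beta>"
    using \<alpha>_eq g by simp
  ultimately show ?thesis
    using that[of \<beta> \<gamma> "nat g"] \<beta> \<beta>_ring \<gamma>_ring det s_gt_2 by (simp add: tot_pos_intsI)
qed

text \<open>Among the bases whose cone contains \<alpha>, take one with least sum of traces. If
  \<beta> - \<gamma> were totally positive, it could replace \<beta>: the new coordinates of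
  \<alpha> are \<open>e\<close> and \<open>e + f\<close>, still natural numbers, and the sum of
  traces drops by the trace of \<gamma>. The other difference is symmetric.\<close>

lemma exists_reduced_basis:
  assumes "\<alpha> \<in> tot_pos_ints D"
  obtains \<beta> \<gamma> and e f :: nat
  where "\<beta> \<in> tot_pos_ints D" "\<gamma> \<in> tot_pos_ints D" "\<bar>det \<beta> \<gamma>\<bar> = s"
    "\<alpha> = of_nat e * \<beta> + of_nat f * \<gamma>" "\<beta> - \<gamma> \<notin> tot_pos_ints D" "\<gamma> - \<beta> \<notin> tot_pos_ints D"
proof -
  define P where "P = (\<lambda>(\<beta>, \<gamma>, e :: nat, f :: nat). \<beta> \<in> tot_pos_ints D \<and> \<gamma> \<in> tot_pos_ints D \<and>
    \<bar>det \<beta> \<gamma>\<bar> = s \<and> \<alpha> = of_nat e * \<beta> + of_nat f * \<gamma>)"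
  \<comment> \<open>Traces are integers, so the floor loses nothing; it makes the measure a natural
    number, which attains a minimum.\<close>
  define \<mu> where "\<mu> = (\<lambda>(\<beta>, \<gamma>, e :: nat, f :: nat). nat \<lfloor>(\<beta> + conj \<beta>) + (\<gamma> + conj \<gamma>)\<rfloor>)"
  obtain \<beta>\<^sub>0 \<gamma>\<^sub>0 and n :: nat where "\<beta>\<^sub>0 \<in> tot_pos_ints D" "\<gamma>\<^sub>0 \<in> tot_pos_ints D" "\<bar>det \<beta>\<^sub>0 \<gamma>\<^sub>0\<bar> = s"
    "\<alpha> = of_nat n * \<beta>\<^sub>0"
    using exists_tot_pos_basis_on_ray[OF assms] .
  then have "P (\<beta>\<^sub>0, \<gamma>\<^sub>0, n, 0)"
    by (simp add: P_def)
  then obtain b where "P b" and min_b: "\<And>c. P c \<Longrightarrow> \<mu> b \<le> \<mu> c"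
    using ex_has_least_nat[of P _ \<mu>] by blast
  moreover obtain \<beta> \<gamma> e f where b: "b = (\<beta>, \<gamma>, e, f)"
    by (cases b)
  ultimately have \<beta>: "\<beta> \<in> tot_pos_ints D" and \<gamma>: "\<gamma> \<in> tot_pos_ints D" and d: "\<bar>det \<beta> \<gamma>\<bar> = s"
    and \<alpha>: "\<alpha> = of_nat e * \<beta> + of_nat f * \<gamma>"
    by (simp_all add: P_def)
  note ring = tot_pos_intsD(1)[OF \<beta>] tot_pos_intsD(1)[OF \<gamma>]
  have "\<beta> - \<gamma> \<notin> tot_pos_ints D"
  proof
    assume sub: "\<beta> - \<gamma> \<in> tot_pos_ints D"
    have conj_sub: "conj (\<beta> - \<gamma>) = conj \<beta> - conj \<gamma>"
      using ring_of_ints_diff(2) ring by simp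
    have "det (\<beta> - \<gamma>) \<gamma> = det \<beta> \<gamma>"
      unfolding det_def conj_sub by (simp add: algebra_simps)
    then have "P (\<beta> - \<gamma>, \<gamma>, e, e + f)"
      using sub \<gamma> d \<alpha> by (simp add: P_def algebra_simps)
    then have "\<mu> b \<le> \<mu> (\<beta> - \<gamma>, \<gamma>, e, e + f)"
      by (rule min_b)
    then have "nat \<lfloor>(\<beta> + conj \<beta>) + (\<gamma> + conj \<gamma>)\<rfloor> \<le> nat \<lfloor>\<beta> + conj \<beta>\<rfloor>"
      by (simp add: \<mu>_def b conj_sub algebra_simps)
    moreover have "\<lfloor>\<beta> + conj \<beta>\<rfloor> + 1 \<le> \<lfloor>(\<beta> + conj \<beta>) + (\<gamma> + conj \<gamma>)\<rfloor>" "\<lfloor>\<beta> + conj \<beta>\<rfloor> \<ge> 0"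
      using trace_ge_1[OF \<gamma>] trace_ge_1[OF \<beta>] by linarith+
    ultimately show False
      by linarith
  qed
  moreover have "\<gamma> - \<beta> \<notin> tot_pos_ints D"
  proof
    assume sub: "\<gamma> - \<beta> \<in> tot_pos_ints D"
    have conj_sub: "conj (\<gamma> - \<beta>) = conj \<gamma> - conj \<beta>"
      using ring_of_ints_diff(2) ring by simp
    have "det \<beta> (\<gamma> - \<beta>) = det \<beta> \<gamma>"
      unfolding det_def conj_sub by (simp add: algebra_simps)
    then have "P (\<beta>, \<gamma> - \<beta>, e + f, f)"
      using sub \<beta> d \<alpha> by (simp add: P_def algebra_simps)
    then have "\<mu> b \<le> \<mu> (\<beta>, \<gamma> - \<beta>, e + f, f)"
      by (rule min_b)
    then have "nat \<lfloor>(\<beta> + conj \<beta>) + (\<gamma> + conj \<gamma>)\<rfloor> \<le> nat \<lfloor>\<gamma> + conj \<gamma>\<rfloor>"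
      by (simp add: \<mu>_def b conj_sub algebra_simps)
    moreover have "\<lfloor>\<gamma> + conj \<gamma>\<rfloor> + 1 \<le> \<lfloor>(\<beta> + conj \<beta>) + (\<gamma> + conj \<gamma>)\<rfloor>" "\<lfloor>\<gamma> + conj \<gamma>\<rfloor> \<ge> 0"
      using trace_ge_1[OF \<gamma>] trace_ge_1[OF \<beta>] by linarith+
    ultimately show False
      by linarith
  qed
  ultimately show ?thesis
    using that \<beta> \<gamma> d \<alpha> by blast
qed

text \<open>With \<open>P = - p\<close>, total positivity of \<open>x\<close> and
  \<open>\<beta> - x\<close> says P \<beta> < q \<gamma> < (P + 1) \<beta> in both embeddings. If q
  is at least P + 1, then \<gamma> < \<beta> in both embeddings, and if q is at most P, then \<beta>
  < \<gamma> in both; a reduced basis excludes either.\<close>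

lemma reduced_basis_no_split:
  assumes \<beta>: "\<beta> \<in> tot_pos_ints D" and \<gamma>: "\<gamma> \<in> tot_pos_ints D"
    and reduced: "\<beta> - \<gamma> \<notin> tot_pos_ints D" "\<gamma> - \<beta> \<notin> tot_pos_ints D"
    and x: "x = of_int p * \<beta> + of_int q * \<gamma>" "x \<in> tot_pos_ints D" "\<beta> - x \<in> tot_pos_ints D"
    and q: "q > 0"
  shows False
proof -
  note ring = tot_pos_intsD(1)[OF \<beta>] tot_pos_intsD(1)[OF \<gamma>]
  note pos = tot_pos_intsD(2,3)[OF \<beta>] tot_pos_intsD(2,3)[OF \<gamma>]
  have conj_x: "conj x = of_int p * conj \<beta> + of_int q * conj \<gamma>"
    unfolding x(1) by (rule ring_of_ints_combine(2)[OF ring])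
  define P where "P = - p"
  have lt1: "of_int P * \<beta> < of_int q * \<gamma>" "of_int P * conj \<beta> < of_int q * conj \<gamma>"
    using tot_pos_intsD(2,3)[OF x(2)] by (simp_all add: conj_x P_def) (simp_all add: x(1))
  have "x < \<beta>" "conj x < conj \<beta>"
    using x(3) tot_pos_ints_diff_iff[OF ring(1) tot_pos_intsD(1)[OF x(2)]] by simp_all
  then have lt2: "of_int q * \<gamma> < of_int (P + 1) * \<beta>" "of_int q * conj \<gamma> < of_int (P + 1) * conj \<beta>"
    by (simp_all add: conj_x P_def algebra_simps) (simp_all add: x(1) algebra_simps)
  have "0 < of_int q * \<gamma>"
    using q pos by simp
  with lt2(1) have "0 < of_int (P + 1) * \<beta>"
    by linarith
  then have P: "P + 1 > 0"
    using pos(1) zero_less_mult_pos2[of "of_int (P + 1)" \<beta>] by linarith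
  show False
  proof (cases "q \<ge> P + 1")
    case True
    have "of_int (P + 1) * \<gamma> \<le> of_int q * \<gamma>" "of_int (P + 1) * conj \<gamma> \<le> of_int q * conj \<gamma>"
      using True pos by (intro mult_right_mono; simp)+
    with lt2 have "of_int (P + 1) * \<gamma> < of_int (P + 1) * \<beta>" "of_int (P + 1) * conj \<gamma> < of_int (P + 1) * conj \<beta>"
      by linarith+
    moreover have "(0::real) < of_int (P + 1)"
      using P by linarith
    ultimately have "\<gamma> < \<beta>" "conj \<gamma> < conj \<beta>"
      by (simp_all only: mult_less_cancel_left_pos)
    then show False
      using reduced(1) tot_pos_ints_diff_iff[OF ring] by simp
  next
    case False
    have "of_int q * \<beta> \<le> of_int P * \<beta>" "of_int q * conj \<beta> \<le> of_int P * conj \<beta>"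
      using False pos by (intro mult_right_mono; simp)+
    with lt1 have "of_int q * \<beta> < of_int q * \<gamma>" "of_int q * conj \<beta> < of_int q * conj \<gamma>"
      by linarith+
    then have "\<beta> < \<gamma>" "conj \<beta> < conj \<gamma>"
      using q by simp_all
    then show False
      using reduced(2) tot_pos_ints_diff_iff[OF ring(2,1)] by simp
  qed
qed

text \<open>In a splitting \<beta> = x + y the \<gamma>-coordinates of \<open>x\<close> and
  \<open>y\<close> are opposite. If they are nonzero, the summand with the positive one contradicts
  the previous lemma; if they are zero, \<open>p\<close> and \<open>1 - p\<close> would both be
  positive integers.\<close>

lemma reduced_basis_indecomposable:
  assumes \<beta>: "\<beta> \<in> tot_pos_ints D" and \<gamma>: "\<gamma> \<in> tot_pos_ints D" and det: "\<bar>det \<beta> \<gamma>\<bar> = s"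
    and reduced: "\<beta> - \<gamma> \<notin> tot_pos_ints D" "\<gamma> - \<beta> \<notin> tot_pos_ints D"
  shows "\<beta> \<in> indecomposables D"
proof -
  have False if x: "x \<in> tot_pos_ints D" and y: "y \<in> tot_pos_ints D" and \<beta>_eq: "\<beta> = x + y" for x y
  proof -
    obtain p q where pq: "x = of_int p * \<beta> + of_int q * \<gamma>"
      using basis_coordinates[OF tot_pos_intsD(1)[OF \<beta>] tot_pos_intsD(1)[OF \<gamma>] det tot_pos_intsD(1)[OF x]] .
    have y_eq: "y = of_int (1 - p) * \<beta> + of_int (- q) * \<gamma>"
    proof -
      have "y = \<beta> - x" using \<beta>_eq by simp
      then show ?thesis by (simp add: pq algebra_simps)
    qed
    consider "q > 0" | "q = 0" | "q < 0"
      by linarith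
    then show False
    proof cases
      case 1
      show False
        by (rule reduced_basis_no_split[OF \<beta> \<gamma> reduced pq x _ 1]) (use y \<beta>_eq in simp)
    next
      case 2
      have "of_int p * \<beta> > 0" "of_int (1 - p) * \<beta> > 0"
        using pq y_eq 2 tot_pos_intsD(2)[OF x] tot_pos_intsD(2)[OF y] by simp_all
      then have "of_int p > (0::real)" "of_int (1 - p) > (0::real)"
        using tot_pos_intsD(2)[OF \<beta>] zero_less_mult_pos2 by blast+
      then have "0 < p" "0 < 1 - p"
        by (simp_all only: of_int_0_less_iff)
      then show False
        by linarith
    next
      case 3
      show False
        by (rule reduced_basis_no_split[OF \<beta> \<gamma> reduced y_eq y]) (use x \<beta>_eq 3 in simp_all)
    qed
  qed
  then show ?thesis
    using \<beta> by (auto simp: indecomposables_def)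
qed

section \<open>Existence and finiteness of partitions\<close>

lemma indec_partition_exists:
  assumes "x \<in> tot_pos_ints D"
  obtains M where "M \<in> indec_partitions D x"
proof -
  have "\<exists>M. M \<in> indec_partitions D x"
    using assms
  \<comment> \<open>Traces of totally positive elements are integers at least 1, so both parts of a
    splitting have smaller trace.\<close>
  proof (induction "nat \<lfloor>x + conj x\<rfloor>" arbitrary: x rule: less_induct)
    case less
    show ?case
    proof (cases "x \<in> indecomposables D")
      case True
      then have "{#x#} \<in> indec_partitions D x"
        by (simp add: indec_partitions_def)
      then show ?thesis ..
    next
      case False
      then obtain y z where yz: "y \<in> tot_pos_ints D" "z \<in> tot_pos_ints D" "x = y + z"
        using less.prems by (auto simp: indecomposables_def)
      have conj_x: "conj x = conj y + conj z"
        using ring_of_ints_add(2)[of y z] yz tot_pos_intsD(1) by simp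
      have "nat \<lfloor>y + conj y\<rfloor> < nat \<lfloor>x + conj x\<rfloor>" "nat \<lfloor>z + conj z\<rfloor> < nat \<lfloor>x + conj x\<rfloor>"
        using trace_ge_1[OF yz(1)] trace_ge_1[OF yz(2)] unfolding yz(3) conj_x[unfolded yz(3)]
        by linarith+
      then obtain M N where "M \<in> indec_partitions D y" "N \<in> indec_partitions D z"
        using less.hyps yz by blast
      then have "M + N \<in> indec_partitions D x"
        by (auto simp: indec_partitions_def yz(3))
      then show ?thesis ..
    qed
  qed
  then show ?thesis
    using that by blast
qed

text \<open>Both \<open>x\<close> and x' lie between 0 and \<open>T\<close>. The difference x - x' =
  q s therefore bounds \<open>q\<close>, and then x = p + q \<omega> bounds
  \<open>p\<close>.\<close>

lemma finite_tot_pos_ints_trace_le: "finite {x \<in> tot_pos_ints D. x + conj x \<le> T}"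
proof -
  define K where "K = \<lceil>T + T * \<bar>\<omega>\<bar>\<rceil>"
  have "{x \<in> tot_pos_ints D. x + conj x \<le> T} \<subseteq> (\<lambda>(p, q). of_int p + of_int q * \<omega>) ` ({-K..K} \<times> {-K..K})"
  proof
    fix x assume x: "x \<in> {x \<in> tot_pos_ints D. x + conj x \<le> T}"
    then have pos: "x > 0" "conj x > 0" and T: "x + conj x \<le> T"
      by (auto dest: tot_pos_intsD)
    have "x \<in> ring_of_ints D"
      using x by (auto dest: tot_pos_intsD)
    then obtain p q where pq: "x = of_int p + of_int q * \<omega>"
      by (rule ring_of_ints_cases)
    have diff: "x - conj x = of_int q * s"
      unfolding pq conj_lattice by (simp add: algebra_simps)
    have "\<bar>of_int q\<bar> * 1 \<le> \<bar>of_int q\<bar> * s"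
      using s_gt_2 by (intro mult_left_mono) auto
    also have "\<dots> = \<bar>x - conj x\<bar>"
      using s_gt_2 by (simp add: diff abs_mult)
    also have "\<dots> \<le> T"
      using pos T by linarith
    finally have q: "\<bar>of_int q\<bar> \<le> T"
      by simp
    have "\<bar>of_int p\<bar> \<le> \<bar>x\<bar> + \<bar>of_int q * \<omega>\<bar>"
      unfolding pq by linarith
    also have "\<dots> \<le> T + T * \<bar>\<omega>\<bar>"
      unfolding abs_mult using pos T q by (intro add_mono mult_right_mono) auto
    finally have "\<bar>p\<bar> \<le> K"
      unfolding K_def by linarith
    moreover have "T * \<bar>\<omega>\<bar> \<ge> 0"
      using pos T by auto
    then have "\<bar>q\<bar> \<le> K"
      using q unfolding K_def by linarith
    ultimately show "x \<in> (\<lambda>(p, q). of_int p + of_int q * \<omega>) ` ({-K..K} \<times> {-K..K})"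
      unfolding pq by (intro image_eqI[of _ _ "(p, q)"]) (auto simp: abs_le_iff)
  qed
  then show ?thesis
    by (rule finite_subset) auto
qed

lemma conj_0: "conj 0 = 0"
  using conj_lattice[of 0 0] by simp

lemma sum_mset_tot_pos_ints:
  assumes "set_mset M \<subseteq> tot_pos_ints D"
  shows "sum_mset M \<in> ring_of_ints D" and "conj (sum_mset M) = (\<Sum>x\<in>#M. conj x)"
proof -
  have "sum_mset M \<in> ring_of_ints D \<and> conj (sum_mset M) = (\<Sum>x\<in>#M. conj x)"
    using assms
  proof (induction M)
    case empty
    show ?case
      using lattice_in_ring_of_ints[of 0 0] by (simp add: conj_0)
  next
    case (add x M)
    then show ?case
      using ring_of_ints_add[of x "sum_mset M"] tot_pos_intsD(1)[of x] by simp
  qed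
  then show "sum_mset M \<in> ring_of_ints D" "conj (sum_mset M) = (\<Sum>x\<in>#M. conj x)"
    by blast+
qed

text \<open>The traces of the parts are at least 1 and add up to the trace of \<open>x\<close>,
  which bounds both the number of parts and the trace of each. Finiteness is what allows
  \<open>card\<close> to be bounded below by exhibiting partitions.\<close>

lemma finite_indec_partitions: "finite (indec_partitions D x)"
proof -
  define T where "T = x + conj x"
  have "indec_partitions D x \<subseteq> {M. set_mset M \<subseteq> {x \<in> tot_pos_ints D. x + conj x \<le> T} \<and> size M \<le> nat \<lfloor>T\<rfloor>}"
  proof
    fix M assume M: "M \<in> indec_partitions D x"
    then have tp: "set_mset M \<subseteq> tot_pos_ints D" and sum: "sum_mset M = x"
      by (auto simp: indec_partitions_def dest: indecomposablesD)
    have T: "T = (\<Sum>y\<in>#M. y + conj y)"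
      using sum_mset_tot_pos_ints(2)[OF tp] by (simp add: T_def sum sum_mset.distrib)
    have "of_nat (size M) = (\<Sum>y\<in>#M. (1::real))"
      by simp
    also have "\<dots> \<le> T"
      unfolding T using tp by (intro sum_mset_mono trace_ge_1) auto
    finally have "size M \<le> nat \<lfloor>T\<rfloor>"
      by linarith
    moreover have "y + conj y \<le> T" if "y \<in># M" for y
    proof -
      obtain N where N: "M = add_mset y N"
        using \<open>y \<in># M\<close> by (meson multi_member_split)
      have "(\<Sum>z\<in>#N. (0::real)) \<le> (\<Sum>z\<in>#N. z + conj z)"
        using tp N trace_ge_1 by (intro sum_mset_mono) force
      then show ?thesis
        by (simp add: T N)
    qed
    ultimately show "M \<in> {M. set_mset M \<subseteq> {x \<in> tot_pos_ints D. x + conj x \<le> T} \<and> size M \<le> nat \<lfloor>T\<rfloor>}"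
      using tp by auto
  qed
  then show ?thesis
    by (rule finite_subset) (intro finite_multisets_size_le finite_tot_pos_ints_trace_le)
qed

section \<open>Splitting multiples of a basis vector; norms of indecomposables\<close>

lemma conj_eq_0_imp:
  assumes "x \<in> ring_of_ints D" "conj x = 0"
  shows "x = 0"
proof -
  obtain p q where x: "x = of_int p + of_int q * \<omega>"
    using assms(1) by (rule ring_of_ints_cases)
  obtain t n where tn: "\<omega> + (\<omega> - s) = of_int t" "\<omega> * (\<omega> - s) = of_int n"
    by (rule obtain_omega_polynomial)
  \<comment> \<open>As \<omega> - s = t - \<omega>, the conjugate of \<open>x\<close> is again a
    lattice element, with coordinates \<open>p + q * t\<close> and \<open>- q\<close>.\<close>
  have "of_int (p + q * t) + of_int (- q) * \<omega> = of_int p + of_int q * (\<omega> + (\<omega> - s)) - of_int q * \<omega>"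
    unfolding tn by simp
  also have "\<dots> = conj x"
    unfolding x conj_lattice by (simp add: algebra_simps)
  finally have "of_int (p + q * t) + of_int (- q) * \<omega> = 0"
    by (simp only: assms(2))
  then have "p + q * t = 0 \<and> - q = 0"
    by (simp only: lattice_eq_0_iff)
  then have "q = 0" "p = 0"
    by auto
  then show ?thesis
    by (simp add: x)
qed

lemma conj_add_multiple:
  assumes "x \<in> ring_of_ints D" "y \<in> ring_of_ints D"
  shows "x + of_int k * y \<in> ring_of_ints D" and "conj (x + of_int k * y) = conj x + of_int k * conj y"
  using ring_of_ints_combine[OF assms, of 1 k] by simp_all

text \<open>The ratios \<gamma> / \<beta> and \<gamma>' / \<beta>' differ by s / N(\<beta>), because
  the determinant has modulus \<open>s\<close>. Since \<open>v\<close> exceeds this distance by more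
  than 1, one integer translation moves both ratios into the open interval from 0 to
  \<open>v\<close>. The nonzero determinant records that \<open>z\<close> is not a multiple of
  \<beta>.\<close>

lemma multiple_nontrivial_split:
  assumes \<beta>: "\<beta> \<in> tot_pos_ints D" and \<gamma>: "\<gamma> \<in> tot_pos_ints D" and det: "\<bar>det \<beta> \<gamma>\<bar> = s"
    and v: "real v > s / (\<beta> * conj \<beta>) + 1"
  obtains z where "z \<in> tot_pos_ints D" "of_nat v * \<beta> - z \<in> tot_pos_ints D" "det z \<beta> \<noteq> 0"
proof -
  note ring = tot_pos_intsD(1)[OF \<gamma>] tot_pos_intsD(1)[OF \<beta>]
  note pos = tot_pos_intsD(2,3)[OF \<beta>]
  define a where "a = \<gamma> / \<beta>"
  define a' where "a' = conj \<gamma> / conj \<beta>"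
  have \<gamma>_eq: "\<gamma> = a * \<beta>" "conj \<gamma> = a' * conj \<beta>"
    using pos by (simp_all add: a_def a'_def)
  have "det \<beta> \<gamma> = (a' - a) * (\<beta> * conj \<beta>)"
    unfolding det_def by (simp add: \<gamma>_eq(2)) (simp add: \<gamma>_eq(1) algebra_simps)
  then have "\<bar>a' - a\<bar> * (\<beta> * conj \<beta>) = s"
    using det pos by (simp add: abs_mult)
  then have width: "\<bar>a' - a\<bar> = s / (\<beta> * conj \<beta>)"
    using pos by (simp add: field_simps)
  \<comment> \<open>The least integer making both translates positive: the smaller one is then at
    most 1, the larger one at most 1 + s / N(\<beta>) < v.\<close>
  define t where "t = \<lfloor>- min a a'\<rfloor> + 1"
  have t: "0 < a + of_int t" "0 < a' + of_int t" "a + of_int t < real v" "a' + of_int t < real v"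
    using v width unfolding t_def by linarith+
  define z where "z = \<gamma> + of_int t * \<beta>"
  have z_ring: "z \<in> ring_of_ints D" and conj_z: "conj z = (a' + of_int t) * conj \<beta>"
    using conj_add_multiple[OF ring, of t] by (simp_all add: z_def \<gamma>_eq(2) algebra_simps)
  have z_eq: "z = (a + of_int t) * \<beta>"
    unfolding z_def by (simp add: \<gamma>_eq(1) algebra_simps)
  have z: "z \<in> tot_pos_ints D"
  proof (rule tot_pos_intsI[OF z_ring])
    show "z > 0"
      unfolding z_eq using t pos by simp
    show "conj z > 0"
      unfolding conj_z using t pos by simp
  qed
  have v_ring: "of_nat v * \<beta> \<in> ring_of_ints D" and conj_v: "conj (of_nat v * \<beta>) = of_nat v * conj \<beta>"
    using ring_of_ints_scale[OF ring(2), of "int v"] by simp_all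
  have "z < of_nat v * \<beta>" "conj z < of_nat v * conj \<beta>"
    unfolding conj_z unfolding z_eq using t pos by (simp_all add: mult_strict_right_mono)
  then have "of_nat v * \<beta> - z \<in> tot_pos_ints D"
    using tot_pos_ints_diff_iff[OF v_ring z_ring] conj_v by simp
  moreover have "det z \<beta> = - det \<beta> \<gamma>"
    unfolding det_def conj_z \<gamma>_eq(2) unfolding z_eq by (simp add: \<gamma>_eq(1) algebra_simps)
  then have "det z \<beta> \<noteq> 0"
    using det s_gt_2 by auto
  ultimately show ?thesis
    using that z by blast
qed

text \<open>No lattice point lies in the open box spanned by an indecomposable \<open>\<beta>\<close>, so \<open>\<gamma>\<close> can be reduced modulo
  \<open>\<beta>\<close> to an element \<open>g\<close> of mixed signature. Then \<open>\<beta> g'\<close> and \<open>- \<beta>' g\<close> have equal sign, the modulus of their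
  sum is \<open>s\<close> and their product is at least \<open>\<beta> \<beta>'\<close>, since the norm of \<open>g\<close> is a nonzero integer.\<close>

lemma indecomposable_norm_le:
  assumes \<beta>: "\<beta> \<in> indecomposables D" and \<gamma>: "\<gamma> \<in> ring_of_ints D" and det: "\<bar>det \<beta> \<gamma>\<bar> = s"
  shows "4 * (\<beta> * conj \<beta>) \<le> s\<^sup>2"
proof -
  have \<beta>_tp: "\<beta> \<in> tot_pos_ints D"
    using \<beta> by (rule indecomposablesD)
  note \<beta>_ring = tot_pos_intsD(1)[OF \<beta>_tp] and pos = tot_pos_intsD(2,3)[OF \<beta>_tp]
  have *: "\<gamma> + of_int k * \<beta> \<in> ring_of_ints D \<and> det \<beta> (\<gamma> + of_int k * \<beta>) = det \<beta> \<gamma>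
      \<and> conj (\<gamma> + of_int k * \<beta>) = conj \<gamma> + of_int k * conj \<beta> \<and> conj (\<gamma> + of_int k * \<beta>) \<noteq> 0" for k
  proof -
    have ring: "\<gamma> + of_int k * \<beta> \<in> ring_of_ints D"
      and cj: "conj (\<gamma> + of_int k * \<beta>) = conj \<gamma> + of_int k * conj \<beta>"
      using conj_add_multiple[OF \<gamma> \<beta>_ring] by simp_all
    have d: "det \<beta> (\<gamma> + of_int k * \<beta>) = det \<beta> \<gamma>"
      unfolding det_def cj by (simp add: algebra_simps)
    have "conj (\<gamma> + of_int k * \<beta>) \<noteq> 0"
    proof
      assume "conj (\<gamma> + of_int k * \<beta>) = 0"
      then have "\<gamma> + of_int k * \<beta> = 0"
        using conj_eq_0_imp ring by blast
      then have "det \<beta> \<gamma> = 0"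
        using d by (simp add: det_def conj_0)
      then show False
        using det s_gt_2 by simp
    qed
    with ring cj d show ?thesis
      by blast
  qed
  \<comment> \<open>Chosen so that \<open>h\<close> lies between 0 and \<beta> in the first
    embedding.\<close>
  define n where "n = - \<lfloor>\<gamma> / \<beta>\<rfloor>"
  define h where "h = \<gamma> + of_int n * \<beta>"
  have "of_int \<lfloor>\<gamma> / \<beta>\<rfloor> * \<beta> \<le> \<gamma>" "\<gamma> < (of_int \<lfloor>\<gamma> / \<beta>\<rfloor> + 1) * \<beta>"
    using pos floor_correct[of "\<gamma> / \<beta>"] by (simp_all only: pos_le_divide_eq pos_divide_less_eq of_int_add of_int_1)
  then have h_bounds: "0 \<le> h" "h < \<beta>"
    by (simp_all add: h_def n_def algebra_simps)
  have h_ring: "h \<in> ring_of_ints D"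
    using * by (simp add: h_def)
  have conj_h: "conj h \<noteq> 0"
    unfolding h_def using * by blast
  then have h_pos: "h > 0"
    using h_bounds(1) conj_0 by (cases "h = 0") simp_all
  \<comment> \<open>Take \<open>h\<close> itself if h' < 0. Otherwise h' is at least \<beta>', as
    \<beta> = h + (\<beta> - h) would be a splitting, and \<open>h - \<beta>\<close> is negative
    with positive conjugate.\<close>
  have "\<exists>g. g \<in> ring_of_ints D \<and> det \<beta> g = det \<beta> \<gamma> \<and> g * conj g < 0"
  proof (cases "conj h < 0")
    case True
    then show ?thesis
      using h_pos * by (intro exI[of _ h]) (simp add: h_def mult_pos_neg)
  next
    case False
    then have conj_h_pos: "conj h > 0"
      using conj_h by simp
    have "\<not> conj h < conj \<beta>"
    proof
      assume "conj h < conj \<beta>"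
      then have "\<beta> - h \<in> tot_pos_ints D"
        using h_bounds tot_pos_ints_diff_iff[OF \<beta>_ring h_ring] by simp
      moreover have "h \<in> tot_pos_ints D"
        using h_ring h_pos conj_h_pos by (rule tot_pos_intsI)
      moreover have "\<beta> = h + (\<beta> - h)"
        by simp
      ultimately show False
        using \<beta> unfolding indecomposables_def by blast
    qed
    define g where "g = \<gamma> + of_int (n - 1) * \<beta>"
    have g: "g \<in> ring_of_ints D" "det \<beta> g = det \<beta> \<gamma>" "conj g \<noteq> 0"
      and conj_g: "conj g = conj \<gamma> + of_int (n - 1) * conj \<beta>"
      using *[of "n - 1"] by (auto simp: g_def)
    have "conj h = conj \<gamma> + of_int n * conj \<beta>"
      using * by (simp add: h_def)
    then have "conj g = conj h - conj \<beta>"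
      unfolding conj_g by (simp add: algebra_simps)
    with \<open>\<not> conj h < conj \<beta>\<close> g(3) have "conj g > 0"
      by linarith
    moreover have "g < 0"
      using h_bounds by (simp add: g_def h_def algebra_simps)
    ultimately show ?thesis
      using g by (intro exI[of _ g]) (simp add: mult_neg_pos)
  qed
  then obtain g where g: "g \<in> ring_of_ints D" "det \<beta> g = det \<beta> \<gamma>" "g * conj g < 0"
    by blast
  have "g * conj g \<in> \<int>"
    using g(1) by (rule norm_in_Ints)
  then have norm_g: "g * conj g \<le> -1"
    using g(3) by (auto elim!: Ints_cases)
  have "4 * (\<beta> * conj \<beta>) \<le> 4 * (\<beta> * conj \<beta>) * (- (g * conj g))"
    using mult_left_mono[of 1 "- (g * conj g)" "4 * (\<beta> * conj \<beta>)"] norm_g pos by simp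
  also have "\<dots> \<le> 4 * (\<beta> * conj \<beta>) * (- (g * conj g)) + (\<beta> * conj g + conj \<beta> * g)\<^sup>2"
    by simp
  also have "\<dots> = (det \<beta> g)\<^sup>2"
    unfolding det_def by (simp add: power2_eq_square algebra_simps)
  also have "\<dots> = s\<^sup>2"
    using det g(2) by (metis power2_abs)
  finally show ?thesis .
qed

section \<open>Counting partitions by exchanges\<close>

lemma card_indec_partitions_gt:
  assumes \<alpha>: "\<alpha> > 0" "\<alpha> = of_nat e * \<beta> + sum_mset R"
    and \<beta>: "\<beta> \<in> indecomposables D" and R: "set_mset R \<subseteq> indecomposables D"
    and Z: "Z \<in> indec_partitions D (of_nat v * \<beta>)" "Z \<noteq> replicate_mset v \<beta>"
    and e: "m * v \<le> e"
  shows "m < num_indec_partitions D \<alpha>"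
proof -
  \<comment> \<open>In \<open>F t\<close>, \<open>t\<close> blocks of \<open>v\<close> copies of
    \<beta> are exchanged for \<open>Z\<close>. As \<open>m * v \<le> e\<close>, this is possible
    for t = 0, ..., m, which gives m + 1 distinct partitions.\<close>
  define F where "F = (\<lambda>t. replicate_mset (e - t * v) \<beta> + repeat_mset t Z + R)"
  have le: "t * v \<le> e" if "t \<le> m" for t
    using that e by (meson mult_le_mono1 order_trans)
  have "F t \<in> indec_partitions D \<alpha>" if "t \<le> m" for t
  proof -
    have "sum_mset (F t) = of_nat (e - t * v) * \<beta> + of_nat t * (of_nat v * \<beta>) + sum_mset R"
      using Z(1) by (simp add: F_def sum_mset_repeat_mset indec_partitions_def)
    also have "\<dots> = \<alpha>"
      using le[OF that] by (simp add: \<alpha>(2) of_nat_diff algebra_simps)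
    finally have sum: "sum_mset (F t) = \<alpha>" .
    moreover from this \<alpha>(1) have "F t \<noteq> {#}"
      by auto
    moreover have "set_mset (F t) \<subseteq> indecomposables D"
      using \<beta> R Z(1) set_mset_repeat_mset_subset[of t Z]
      by (auto simp: F_def indec_partitions_def in_replicate_mset split: if_splits)
    ultimately show ?thesis
      by (simp add: indec_partitions_def)
  qed
  then have "F ` {..m} \<subseteq> indec_partitions D \<alpha>"
    by auto
  then have "card (F ` {..m}) \<le> num_indec_partitions D \<alpha>"
    unfolding num_indec_partitions_def by (intro card_mono finite_indec_partitions)
  moreover have "inj_on F {..m}"
  proof (rule linorder_inj_onI)
    fix t u assume "t < u" "t \<in> {..m}" "u \<in> {..m}"
    then show "F t \<noteq> F u"
      using replicate_repeat_mset_inject[of e t v \<beta> Z u] le[of u] Z(2) by (auto simp: F_def)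
  qed auto
  then have "card (F ` {..m}) = Suc m"
    by (simp add: card_image)
  ultimately show ?thesis
    by simp
qed

lemma indec_multiplicity_le:
  assumes \<alpha>: "\<alpha> > 0" "\<alpha> = of_nat e * \<beta> + sum_mset R" "num_indec_partitions D \<alpha> \<le> m"
    and \<beta>: "\<beta> \<in> indecomposables D" and R: "set_mset R \<subseteq> indecomposables D"
    and \<gamma>: "\<gamma> \<in> tot_pos_ints D" "\<bar>det \<beta> \<gamma>\<bar> = s"
  shows "real e \<le> real m * (s / (\<beta> * conj \<beta>) + 2)"
proof -
  \<comment> \<open>The least integer above s / N(\<beta>) + 1, hence at most s / N(\<beta>) +
    2.\<close>
  define v where "v = nat \<lfloor>s / (\<beta> * conj \<beta>)\<rfloor> + 2"
  have \<beta>_tp: "\<beta> \<in> tot_pos_ints D"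
    using \<beta> by (rule indecomposablesD)
  have "s / (\<beta> * conj \<beta>) \<ge> 0"
    using tot_pos_intsD(2,3)[OF \<beta>_tp] s_gt_2 by simp
  then have v: "real v > s / (\<beta> * conj \<beta>) + 1" "real v \<le> s / (\<beta> * conj \<beta>) + 2"
    unfolding v_def by linarith+
  obtain z where z: "z \<in> tot_pos_ints D" "of_nat v * \<beta> - z \<in> tot_pos_ints D" "det z \<beta> \<noteq> 0"
    using multiple_nontrivial_split[OF \<beta>_tp \<gamma> v(1)] .
  obtain X where X: "X \<in> indec_partitions D z"
    using indec_partition_exists[OF z(1)] .
  obtain Y where Y: "Y \<in> indec_partitions D (of_nat v * \<beta> - z)"
    using indec_partition_exists[OF z(2)] .
  have "X + Y \<in> indec_partitions D (of_nat v * \<beta>)"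
    using X Y by (auto simp: indec_partitions_def)
  \<comment> \<open>Otherwise \<open>X\<close> would consist of copies of \<beta>, and its sum
    \<open>z\<close> would be a multiple of \<beta>, against
    \<open>det z \<beta> \<noteq> 0\<close>.\<close>
  moreover have "X + Y \<noteq> replicate_mset v \<beta>"
  proof
    assume "X + Y = replicate_mset v \<beta>"
    then have "X \<subseteq># replicate_mset v \<beta>"
      by (metis mset_subset_eq_add_left)
    then have "X = replicate_mset (size X) \<beta>"
      by (metis set_mset_mono set_mset_replicate_mset_subset set_mset_subset_singletonD subset_trans
          empty_subsetI order_refl size_replicate_mset)
    then have "z = of_nat (size X) * \<beta>"
      using X by (metis (mono_tags, lifting) indec_partitions_def mem_Collect_eq sum_mset_replicate_mset)
    moreover from this have "conj z = of_nat (size X) * conj \<beta>"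
      using ring_of_ints_scale(2)[OF tot_pos_intsD(1)[OF \<beta>_tp], of "int (size X)"] by simp
    ultimately show False
      using z(3) by (simp add: det_def)
  qed
  ultimately have "\<not> m * v \<le> e"
    using card_indec_partitions_gt[OF \<alpha>(1,2) \<beta> R, of "X + Y" v m] \<alpha>(3) by linarith
  then have "real e \<le> real m * real v"
    by (metis nat_le_linear of_nat_le_iff of_nat_mult)
  also have "\<dots> \<le> real m * (s / (\<beta> * conj \<beta>) + 2)"
    using v(2) by (intro mult_left_mono) auto
  finally show ?thesis .
qed

section \<open>The norm estimate\<close>

lemma multiplicity_bounds:
  fixes N :: real
  assumes N: "1 \<le> N" "4 * N \<le> s\<^sup>2" and e: "real e \<le> real m * (s / N + 2)"
  shows "real e \<le> real m * (s + 2)" and "real e * sqrt N \<le> real m * (s + 2)"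
proof -
  have "s / N \<le> s"
    using N s_gt_2 by (simp add: field_simps)
  then have "real m * (s / N + 2) \<le> real m * (s + 2)"
    by (intro mult_left_mono) auto
  with e show "real e \<le> real m * (s + 2)"
    by linarith
  define r where "r = sqrt N"
  have r: "r \<ge> 1" "r * r = N"
    using N by (simp_all add: r_def)
  have "(2 * r)\<^sup>2 \<le> s\<^sup>2"
    using N(2) r(2) by (simp add: power2_eq_square)
  then have "2 * r \<le> s"
    by (rule power2_le_imp_le) (use s_gt_2 in simp)
  \<comment> \<open>The function s / r + 2 r is convex and equals s + 2 at both ends r = 1 and r = s
    / 2 of the admissible range. This product expresses that it stays below s + 2 in
    between.\<close>
  then have "(r - 1) * (2 * r - s) \<le> 0"
    using r(1) by (simp add: mult_nonneg_nonpos)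
  then have "s + 2 * N \<le> (s + 2) * r"
    by (simp add: r(2)[symmetric] algebra_simps)
  moreover have "(s / N + 2) * N = s + 2 * N"
    using N(1) by (simp add: field_simps)
  ultimately have "(s / N + 2) * N \<le> (s + 2) * r"
    by simp
  then have "(s / N + 2) * r * r \<le> (s + 2) * r"
    using r(2) by (simp add: mult.assoc)
  then have "(s / N + 2) * r \<le> s + 2"
    using r(1) by simp
  then have "real m * ((s / N + 2) * r) \<le> real m * (s + 2)"
    by (rule mult_left_mono) simp
  moreover have "real e * r \<le> real m * (s / N + 2) * r"
    using e r(1) by (intro mult_right_mono) auto
  ultimately show "real e * sqrt N \<le> real m * (s + 2)"
    by (simp add: r_def mult.assoc)
qed

text \<open>The square of the left side is the squared determinant plus 4 N(\<beta>) N(\<gamma>),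
  that is s^2 + (2 r)^2, which is at most (s + 2 r)^2.\<close>

lemma mixed_trace_le:
  assumes "\<beta> \<in> tot_pos_ints D" "\<gamma> \<in> tot_pos_ints D" "\<bar>det \<beta> \<gamma>\<bar> = s"
  shows "\<beta> * conj \<gamma> + conj \<beta> * \<gamma> \<le> s + 2 * (sqrt (\<beta> * conj \<beta>) * sqrt (\<gamma> * conj \<gamma>))"
proof (rule power2_le_imp_le)
  define r where "r = sqrt (\<beta> * conj \<beta>) * sqrt (\<gamma> * conj \<gamma>)"
  have r: "r\<^sup>2 = (\<beta> * conj \<beta>) * (\<gamma> * conj \<gamma>)" "r \<ge> 0"
    using tot_pos_intsD(2,3)[OF assms(1)] tot_pos_intsD(2,3)[OF assms(2)]
    by (simp_all add: r_def power_mult_distrib)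
  have "(\<beta> * conj \<gamma> + conj \<beta> * \<gamma>)\<^sup>2 = (det \<beta> \<gamma>)\<^sup>2 + 4 * ((\<beta> * conj \<beta>) * (\<gamma> * conj \<gamma>))"
    by (simp add: det_def power2_eq_square algebra_simps)
  also have "\<dots> = s\<^sup>2 + 4 * r\<^sup>2"
    using assms(3) r(1) by (metis power2_abs)
  also have "\<dots> \<le> (s + 2 * r)\<^sup>2"
    using r(2) s_gt_2 by (simp add: power2_eq_square algebra_simps)
  finally show "(\<beta> * conj \<gamma> + conj \<beta> * \<gamma>)\<^sup>2 \<le> (s + 2 * (sqrt (\<beta> * conj \<beta>) * sqrt (\<gamma> * conj \<gamma>)))\<^sup>2"
    by (simp add: r_def)
  show "0 \<le> s + 2 * (sqrt (\<beta> * conj \<beta>) * sqrt (\<gamma> * conj \<gamma>))"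
    using r(2) s_gt_2 by (simp add: r_def)
qed

lemma norm_le_of_num_indec_partitions_le:
  assumes \<alpha>: "\<alpha> \<in> tot_pos_ints D" and m: "num_indec_partitions D \<alpha> \<le> m"
  shows "\<alpha> * conj \<alpha> \<le> (s + 4) * (real m * (s + 2))\<^sup>2"
proof -
  obtain \<beta> \<gamma> and e f :: nat where \<beta>: "\<beta> \<in> tot_pos_ints D" and \<gamma>: "\<gamma> \<in> tot_pos_ints D"
    and det: "\<bar>det \<beta> \<gamma>\<bar> = s" and \<alpha>_eq: "\<alpha> = of_nat e * \<beta> + of_nat f * \<gamma>"
    and reduced: "\<beta> - \<gamma> \<notin> tot_pos_ints D" "\<gamma> - \<beta> \<notin> tot_pos_ints D"
    using exists_reduced_basis[OF \<alpha>] .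
  have det': "\<bar>det \<gamma> \<beta>\<bar> = s"
    using det by (simp add: abs_det_commute)
  have indec: "\<beta> \<in> indecomposables D" "\<gamma> \<in> indecomposables D"
    using reduced_basis_indecomposable \<beta> \<gamma> det det' reduced by blast+
  note ring = tot_pos_intsD(1)[OF \<beta>] tot_pos_intsD(1)[OF \<gamma>]
  have "real e \<le> real m * (s / (\<beta> * conj \<beta>) + 2)"
    using indec_multiplicity_le[OF tot_pos_intsD(2)[OF \<alpha>] _ m indec(1) _ \<gamma> det, of e "replicate_mset f \<gamma>"]
      indec(2) \<alpha>_eq by (simp add: set_mset_replicate_mset_subset)
  note e = multiplicity_bounds[OF norm_ge_1[OF \<beta>] indecomposable_norm_le[OF indec(1) ring(2) det] this]
  have "real f \<le> real m * (s / (\<gamma> * conj \<gamma>) + 2)"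
    using indec_multiplicity_le[OF tot_pos_intsD(2)[OF \<alpha>] _ m indec(2) _ \<beta> det', of f "replicate_mset e \<beta>"]
      indec(1) \<alpha>_eq by (simp add: set_mset_replicate_mset_subset add.commute)
  note f = multiplicity_bounds[OF norm_ge_1[OF \<gamma>] indecomposable_norm_le[OF indec(2) ring(1) det'] this]
  define M where "M = real m * (s + 2)"
  define x where "x = sqrt (\<beta> * conj \<beta>)"
  define y where "y = sqrt (\<gamma> * conj \<gamma>)"
  have xy: "\<beta> * conj \<beta> = x\<^sup>2" "\<gamma> * conj \<gamma> = y\<^sup>2" "x \<ge> 0" "y \<ge> 0"
    using norm_ge_1[OF \<beta>] norm_ge_1[OF \<gamma>] by (simp_all add: x_def y_def)
  have mixed: "\<beta> * conj \<gamma> + conj \<beta> * \<gamma> \<le> s + 2 * (x * y)"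
    unfolding x_def y_def by (rule mixed_trace_le[OF \<beta> \<gamma> det])
  have conj_\<alpha>: "conj \<alpha> = of_nat e * conj \<beta> + of_nat f * conj \<gamma>"
    using ring_of_ints_combine(2)[OF ring, of "int e" "int f"] by (simp add: \<alpha>_eq)
  have "\<alpha> * conj \<alpha> = (real e)\<^sup>2 * (\<beta> * conj \<beta>) + (real f)\<^sup>2 * (\<gamma> * conj \<gamma>)
      + real e * real f * (\<beta> * conj \<gamma> + conj \<beta> * \<gamma>)"
    unfolding conj_\<alpha> by (simp add: \<alpha>_eq power2_eq_square algebra_simps)
  also have "\<dots> \<le> (real e)\<^sup>2 * x\<^sup>2 + (real f)\<^sup>2 * y\<^sup>2 + real e * real f * (s + 2 * (x * y))"
    unfolding xy(1,2) using mixed by (intro add_left_mono mult_left_mono) simp_all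
  \<comment> \<open>The product of norms in the mixed term completes a square, so the bounds by
    \<open>M\<close> on \<open>e\<close>, \<open>f\<close>, \<open>e x\<close> and
    \<open>f y\<close> suffice.\<close>
  also have "\<dots> = (real e * x + real f * y)\<^sup>2 + s * (real e * real f)"
    by (simp add: power2_eq_square algebra_simps)
  also have "\<dots> \<le> (M + M)\<^sup>2 + s * (M * M)"
    using e f s_gt_2 xy(3,4) unfolding M_def[symmetric] x_def[symmetric] y_def[symmetric]
    by (intro add_mono power_mono mult_left_mono mult_mono) auto
  also have "\<dots> = (s + 4) * M\<^sup>2"
    by (simp add: power2_eq_square algebra_simps)
  finally show ?thesis
    by (simp add: M_def)
qed

end

theorem theorem1p1:
  fixes D :: int and m :: nat and \<alpha> :: real
  assumes "D \<ge> 2" and "squarefree D"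
    and "m \<ge> 1"
    and "\<alpha> \<in> tot_pos_ints D"
    and "num_indec_partitions D \<alpha> \<le> m"
  shows "quad_norm D \<alpha> < (real m)\<^sup>2 * (2 * real m + 1) * (2 * real m + 3) *
           (sqrt (of_int (quad_discr D)) * (sqrt (of_int (quad_discr D)) + 2)\<^sup>2)"
proof -
  interpret real_quadratic D
    using assms(1,2) by unfold_locales
  have "quad_norm D \<alpha> \<le> (s + 4) * (real m * (s + 2))\<^sup>2"
    using norm_le_of_num_indec_partitions_le[OF assms(4,5)] by (simp add: quad_norm_def)
  \<comment> \<open>From s > 2 follows s + 4 < 15 s; the constant 15 = 3 * 5 is the value of (2 m +
    1)(2 m + 3) at m = 1, its minimum for m at least 1.\<close>
  also have "\<dots> < 15 * s * (real m * (s + 2))\<^sup>2"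
    using s_gt_2 assms(3) by (intro mult_strict_right_mono) auto
  also have "\<dots> \<le> ((2 * real m + 1) * (2 * real m + 3)) * s * (real m * (s + 2))\<^sup>2"
  proof -
    have "(3::real) * 5 \<le> (2 * real m + 1) * (2 * real m + 3)"
      using assms(3) by (intro mult_mono) auto
    then show ?thesis
      using s_gt_2 by (intro mult_right_mono) auto
  qed
  finally show ?thesis
    by (simp add: s_def power_mult_distrib mult_ac)
qed

end
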